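(* Let $(\delta_1,Q_1,\{v_1^{\delta_1},\ldots,v_n^{\delta_1}\})$, $(\delta_2,Q_2,\{v_1^{\delta_2},\ldots,v_l^{\delta_2}\})$ and $(\delta_3,Q_3,\{v_1^{\delta_3},\ldots,v_m^{\delta_3}\})$ be cone fundamental triples in $\mathbb{R}^n$, $\mathbb{R}^l$ and $\mathbb{R}^m$ respectively. Let $\delta_1\to\delta_2$ and $\delta_2\to\delta_3$ be cone morphisms defined, respectively, by linear maps $f\colon\mathbb{R}^n\to\mathbb{R}^l$ and $g\colon\mathbb{R}^l\to\mathbb{R}^m$, and let $\Phi_{\delta_2\delta_1}\colon X_{\delta_1}\to X_{\delta_2}$ and $\Psi_{\delta_3\delta_2}\colon X_{\delta_2}\to X_{\delta_3}$ be the corresponding affine toric morphisms. Then $\Psi_{\delta_3\delta_2}\circ\Phi_{\delta_2\delta_1}\colon X_{\delta_1}\to X_{\delta_3}$ is the affine toric morphism induced by the cone morphism $\delta_1\to\delta_3$ defined by $g\circ f$. Moreover, for any cone fundamental triple $(\delta,Q,\{v_1^\delta,\ldots,v_n^\delta\})$, the identity cone morphism $\delta\to\delta$ (defined by the identity of $\mathbb{R}^n$) induces the identity map of $X_\delta$.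
   Context: A quasilattice $Q$ in $\mathbb{R}^n$ is the $\mathbb{Z}$-span of a set of vectors that spans $\mathbb{R}^n$. An $r$-dimensional simplicial cone $\delta\subset\mathbb{R}^n$ ($0\le r\le n$) is the set of non-negative real combinations of $r$ linearly independent vectors (its ray generators); $\{0\}$ is the case $r=0$. A cone fundamental triple $(\delta,Q,\{v_1^\delta,\ldots,v_n^\delta\})$ in $\mathbb{R}^n$ consists of a quasilattice $Q\subset\mathbb{R}^n$, vectors $v_1^\delta,\ldots,v_n^\delta\in Q$ forming a basis of $\mathbb{R}^n$, and a simplicial cone $\delta$ whose ray generators are the $v_i^\delta$ with $i$ in a subset $I_\delta\subseteq\{1,\ldots,n\}$. Let $\alpha_1^\delta,\ldots,\alpha_n^\delta$ be the dual basis of $(\mathbb{R}^n)^*$, let $L_\delta=\bigoplus_i\mathbb{Z}v_i^\delta\subset Q$, and let $\Gamma_\delta=Q/L_\delta$. Put $U_\delta=\{z\in\mathbb{C}^n\mid z_i\neq0\text{ for all }i\notin I_\delta\}$. The group $\Gamma_\delta$ acts on $U_\delta$ by $[v]\cdot(z_1,\ldots,z_n)=(e^{2\pi i\alpha_1^\delta(v)}z_1,\ldots,e^{2\pi i\alpha_n^\delta(v)}z_n)$, $v\in Q$. The affine toric quasifold of the triple is $X_\delta=U_\delta/\Gamma_\delta$; the class of $(z_1,\ldots,z_n)$ is written $[z_1:\cdots:z_n]$. A cone morphism $\delta_1\to\delta_2$ between cones with quasilattices $Q_1\subset\mathbb{R}^n$, $Q_2\subset\mathbb{R}^m$ is a linear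 map $f\colon\mathbb{R}^n\to\mathbb{R}^m$ with $f(Q_1)\subset Q_2$ and $f(\delta_1)\subset\delta_2$. The affine toric morphism induced by it is the (well-defined) map $$\Phi_{\delta_2\delta_1}\colon X_{\delta_1}\to X_{\delta_2},\quad [z_1:\cdots:z_n]\mapsto\left[\prod_{h=1}^n z_h^{\alpha_1^{\delta_2}(f(v_h^{\delta_1}))}:\cdots:\prod_{h=1}^n z_h^{\alpha_m^{\delta_2}(f(v_h^{\delta_1}))}\right].$$ Convention on real powers: for each nonzero $z_h$ choose $x_h\in\mathbb{C}$ with $z_h=e^{2\pi i x_h}$ (the same choice for all monomials) and set $z_h^a=e^{2\pi i a x_h}$ for $a\in\mathbb{R}$; if $z_h=0$, then $z_h^a=0$ for $a>0$ and $z_h^0=1$ (negative exponents do not occur for $z_h=0$). The resulting class does not depend on the choices. *)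

theory Defs
  imports "HOL-Analysis.Analysis" "HOL-Algebra.Group_Action"
begin

text \<open>\<open>int_span S\<close> is the set of finite integer linear combinations of elements of \<open>S\<close>,
  i.e. the library's span over the integers.\<close>

global_interpretation int_module: module "\<lambda>(k::int) (x::'a::real_vector). of_int k *\<^sub>R x"
  defines int_span = "module.span (\<lambda>(k::int) (x::'a::real_vector). of_int k *\<^sub>R x)"
  by unfold_locales (simp_all add: algebra_simps)

definition quasilattice :: "(real ^ 'n) set \<Rightarrow> bool" where
  "quasilattice Q \<longleftrightarrow> (\<exists>S. span S = UNIV \<and> Q = int_span S)"

definition nonneg_span :: "('n \<Rightarrow> real ^ 'm) \<Rightarrow> 'n set \<Rightarrow> (real ^ 'm) set" where
  "nonneg_span v I = {\<Sum>i\<in>I. c i *\<^sub>R v i | c. \<forall>i\<in>I. 0 \<le> c i}"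

record 'n cone_triple =
  cone_of :: "(real ^ 'n) set"
  lattice_of :: "(real ^ 'n) set"
  basis_of :: "'n \<Rightarrow> real ^ 'n"

definition cone_fundamental_triple :: "'n::finite cone_triple \<Rightarrow> bool" where
  "cone_fundamental_triple T \<longleftrightarrow>
     quasilattice (lattice_of T) \<and>
     range (basis_of T) \<subseteq> lattice_of T \<and>
     inj (basis_of T) \<and> independent (range (basis_of T)) \<and> span (range (basis_of T)) = UNIV \<and>
     (\<exists>I. cone_of T = nonneg_span (basis_of T) I)"

text \<open>The index set \<open>I\<close> of the ray generators is determined by the triple;
  see \<open>ray_indices_eq\<close> below.\<close>

definition ray_indices :: "'n::finite cone_triple \<Rightarrow> 'n set" where
  "ray_indices T = (THE I. cone_of T = nonneg_span (basis_of T) I)"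

definition dual_basis :: "('n \<Rightarrow> real ^ 'n) \<Rightarrow> 'n \<Rightarrow> real ^ 'n \<Rightarrow> real" where
  "dual_basis v i = (THE \<alpha>. linear \<alpha> \<and> (\<forall>j. \<alpha> (v j) = (if j = i then 1 else 0)))"

definition additive_group :: "'a::ab_group_add set \<Rightarrow> 'a monoid" where
  "additive_group A = \<lparr>carrier = A, monoid.mult = (+), one = 0\<rparr>"

definition quasi_group :: "'n::finite cone_triple \<Rightarrow> (real ^ 'n) set monoid" where
  "quasi_group T = additive_group (lattice_of T) Mod int_span (range (basis_of T))"

definition toric_domain :: "'n::finite cone_triple \<Rightarrow> (complex ^ 'n) set" where
  "toric_domain T = {z. \<forall>i. i \<notin> ray_indices T \<longrightarrow> z $ i \<noteq> 0}"

text \<open>An element of the quotient group is a coset \<open>\<gamma> = [q]\<close>; its action does not depend on the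
  representative \<open>q\<close>, because the dual basis is integral on the lattice spanned by the basis
  (see \<open>quasi_action_coset\<close> below).\<close>

definition quasi_action ::
    "'n::finite cone_triple \<Rightarrow> (real ^ 'n) set \<Rightarrow> complex ^ 'n \<Rightarrow> complex ^ 'n" where
  "quasi_action T \<gamma> =
     (\<lambda>z\<in>toric_domain T.
        \<chi> i. exp (2 * of_real pi * \<i> * of_real (dual_basis (basis_of T) i (SOME q. q \<in> \<gamma>))) * z $ i)"

definition toric_quasifold :: "'n::finite cone_triple \<Rightarrow> (complex ^ 'n) set set" where
  "toric_quasifold T = orbits (quasi_group T) (toric_domain T) (quasi_action T)"

definition toric_class :: "'n::finite cone_triple \<Rightarrow> complex ^ 'n \<Rightarrow> (complex ^ 'n) set" where
  "toric_class T z = orbit (quasi_group T) (quasi_action T) z"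

definition cone_morphism ::
    "'n::finite cone_triple \<Rightarrow> 'm::finite cone_triple \<Rightarrow> (real ^ 'n \<Rightarrow> real ^ 'm) \<Rightarrow> bool" where
  "cone_morphism T1 T2 f \<longleftrightarrow>
     linear f \<and> f ` lattice_of T1 \<subseteq> lattice_of T2 \<and> f ` cone_of T1 \<subseteq> cone_of T2"

text \<open>\<open>log_choice z x\<close>: the entries of \<open>x\<close> are chosen logarithms of the nonzero entries of \<open>z\<close>.
  \<open>real_power w y a\<close> is the power \<open>w^a\<close> computed with the chosen logarithm \<open>y\<close> of \<open>w\<close>;
  the value for \<open>w = 0\<close> and \<open>a < 0\<close> is a dummy that never occurs for cone morphisms.\<close>

definition log_choice :: "complex ^ 'n \<Rightarrow> complex ^ 'n \<Rightarrow> bool" where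
  "log_choice z x \<longleftrightarrow> (\<forall>h. z $ h \<noteq> 0 \<longrightarrow> z $ h = exp (2 * of_real pi * \<i> * x $ h))"

definition real_power :: "complex \<Rightarrow> complex \<Rightarrow> real \<Rightarrow> complex" where
  "real_power w y a =
     (if w \<noteq> 0 then exp (2 * of_real pi * \<i> * of_real a * y) else if a = 0 then 1 else 0)"

definition toric_monomials ::
    "'n::finite cone_triple \<Rightarrow> 'm::finite cone_triple \<Rightarrow> (real ^ 'n \<Rightarrow> real ^ 'm) \<Rightarrow>
     complex ^ 'n \<Rightarrow> complex ^ 'n \<Rightarrow> complex ^ 'm" where
  "toric_monomials T1 T2 f z x =
     (\<chi> i. \<Prod>h\<in>UNIV. real_power (z $ h) (x $ h) (dual_basis (basis_of T2) i (f (basis_of T1 h))))"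

text \<open>The image of a class is the class of the monomials of any of its representatives, for any
  choice of logarithms; it is unique by \<open>affine_toric_morphism_class\<close> below.\<close>

definition affine_toric_morphism ::
    "'n::finite cone_triple \<Rightarrow> 'm::finite cone_triple \<Rightarrow> (real ^ 'n \<Rightarrow> real ^ 'm) \<Rightarrow>
     (complex ^ 'n) set \<Rightarrow> (complex ^ 'm) set" where
  "affine_toric_morphism T1 T2 f =
     (\<lambda>p\<in>toric_quasifold T1. THE q. \<exists>z\<in>toric_domain T1. \<exists>x. log_choice z x \<and>
        p = toric_class T1 z \<and> q = toric_class T2 (toric_monomials T1 T2 f z x))"

lemma cft_basis:
  assumes "cone_fundamental_triple T"
  shows "inj (basis_of T)" "independent (range (basis_of T))" "span (range (basis_of T)) = UNIV"
  using assms by (auto simp: cone_fundamental_triple_def)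

lemma dual_basis_ex1:
  fixes v :: "'n::finite \<Rightarrow> real ^ 'n"
  assumes "inj v" "independent (range v)" "span (range v) = UNIV"
  shows "\<exists>!\<alpha>::real ^ 'n \<Rightarrow> real. linear \<alpha> \<and> (\<forall>j. \<alpha> (v j) = (if j = i then 1 else 0))"
proof -
  obtain \<alpha> :: "real ^ 'n \<Rightarrow> real" where \<alpha>: "linear \<alpha>"
      "\<forall>x\<in>range v. \<alpha> x = (if x = v i then 1 else 0)"
    using linear_independent_extend[OF assms(2), of "\<lambda>x. if x = v i then 1 else (0::real)"] by blast
  show ?thesis
  proof (rule ex1I[of _ \<alpha>])
    show "linear \<alpha> \<and> (\<forall>j. \<alpha> (v j) = (if j = i then 1 else 0))"
      using \<alpha> assms(1) by (auto simp: inj_eq)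
  next
    fix \<beta> :: "real ^ 'n \<Rightarrow> real"
    assume \<beta>: "linear \<beta> \<and> (\<forall>j. \<beta> (v j) = (if j = i then 1 else 0))"
    show "\<beta> = \<alpha>"
    proof
      fix x
      show "\<beta> x = \<alpha> x"
        by (rule linear_eq_on[where B = "range v"])
           (use \<alpha> \<beta> assms in \<open>auto simp: inj_eq\<close>)
    qed
  qed
qed

lemma dual_basis:
  assumes "cone_fundamental_triple T"
  shows linear_dual_basis: "linear (dual_basis (basis_of T) i)"
    and dual_basis_basis: "dual_basis (basis_of T) i (basis_of T j) = (if j = i then 1 else 0)"
  using theI'[OF dual_basis_ex1[OF cft_basis[OF assms], of i]]
  unfolding dual_basis_def by blast+

lemma dual_basis_expansion:
  assumes "cone_fundamental_triple T"
  shows "x = (\<Sum>j\<in>UNIV. dual_basis (basis_of T) j x *\<^sub>R basis_of T j)"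
proof (rule linear_eq_on[where B = "range (basis_of T)" and f = "\<lambda>x. x"])
  show "linear (\<lambda>x. \<Sum>j\<in>UNIV. dual_basis (basis_of T) j x *\<^sub>R basis_of T j)"
    by (intro linear_compose_sum ballI linear_compose_scale_right linearI)
       (auto simp: linear_add[OF linear_dual_basis[OF assms]]
         linear_scale[OF linear_dual_basis[OF assms]] algebra_simps)
  fix b assume "b \<in> range (basis_of T)"
  then show "b = (\<Sum>j\<in>UNIV. dual_basis (basis_of T) j b *\<^sub>R basis_of T j)"
    by (auto simp: dual_basis_basis[OF assms] if_distrib[of "\<lambda>c. c *\<^sub>R _"] cong: if_cong)
qed (use cft_basis[OF assms] in \<open>auto simp: linear_id[unfolded id_def]\<close>)

lemma nonneg_span_iff:
  assumes "cone_fundamental_triple T"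
  shows "x \<in> nonneg_span (basis_of T) I \<longleftrightarrow>
    (\<forall>i\<in>I. 0 \<le> dual_basis (basis_of T) i x) \<and> (\<forall>i. i \<notin> I \<longrightarrow> dual_basis (basis_of T) i x = 0)"
    (is "_ \<longleftrightarrow> ?R")
proof
  assume "x \<in> nonneg_span (basis_of T) I"
  then obtain c where c: "\<forall>i\<in>I. 0 \<le> c i" "x = (\<Sum>i\<in>I. c i *\<^sub>R basis_of T i)"
    by (auto simp: nonneg_span_def)
  have "dual_basis (basis_of T) i x = (if i \<in> I then c i else 0)" for i
    unfolding c(2)
    by (simp add: linear_sum[OF linear_dual_basis[OF assms]]
      linear_scale[OF linear_dual_basis[OF assms]] dual_basis_basis[OF assms]
      if_distrib[of "\<lambda>x. _ * x"] cong: if_cong)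
  then show ?R using c(1) by auto
next
  assume R: ?R
  have "x = (\<Sum>j\<in>I. dual_basis (basis_of T) j x *\<^sub>R basis_of T j)"
    by (subst dual_basis_expansion[OF assms, of x], rule sum.mono_neutral_right) (use R in auto)
  then show "x \<in> nonneg_span (basis_of T) I"
    unfolding nonneg_span_def using R by (intro CollectI exI[of _ "\<lambda>j. dual_basis (basis_of T) j x"]) simp
qed

lemma ray_indices_eq:
  assumes "cone_fundamental_triple T"
  shows "cone_of T = nonneg_span (basis_of T) I \<longleftrightarrow> I = ray_indices T"
proof -
  have *: "basis_of T i \<in> nonneg_span (basis_of T) J \<longleftrightarrow> i \<in> J" for i J
    by (auto simp: nonneg_span_iff[OF assms] dual_basis_basis[OF assms])
  have uniq: "J = J'" if "nonneg_span (basis_of T) J = nonneg_span (basis_of T) J'" for J J'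
    using * that by blast
  obtain J where J: "cone_of T = nonneg_span (basis_of T) J"
    using assms by (auto simp: cone_fundamental_triple_def)
  have "ray_indices T = J"
    unfolding ray_indices_def by (rule the_equality) (use J uniq in auto)
  with J uniq show ?thesis by auto
qed

lemma dual_basis_int_span:
  assumes "cone_fundamental_triple T" and "x \<in> int_span (range (basis_of T))"
  shows "dual_basis (basis_of T) i x \<in> \<int>"
  using assms(2)
proof (induction rule: int_module.span_induct_alt)
  case base
  show ?case by (simp add: linear_0[OF linear_dual_basis[OF assms(1)]])
next
  case (step c x y)
  then show ?case
    by (auto simp: linear_add[OF linear_dual_basis[OF assms(1)]]
      linear_scale[OF linear_dual_basis[OF assms(1)]] dual_basis_basis[OF assms(1)])
qed

lemma lattice_int_span:
  assumes "cone_fundamental_triple T"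
  obtains S where "lattice_of T = int_span S"
  using assms by (auto simp: cone_fundamental_triple_def quasilattice_def)

lemma exp_2pi_Ints: "x \<in> \<int> \<Longrightarrow> exp (2 * of_real pi * \<i> * of_real (x::real)) = 1"
  by (auto elim!: Ints_cases simp: exp_eq_1)

lemma carrier_quasi_group:
  "carrier (quasi_group T) = (\<lambda>q. {l + q |l. l \<in> int_span (range (basis_of T))}) ` lattice_of T"
  by (auto simp: quasi_group_def carrier_FactGroup r_coset_def additive_group_def)

lemma quasi_action_coset:
  assumes "cone_fundamental_triple T" and "z \<in> toric_domain T"
    and "\<gamma> = {l + q |l. l \<in> int_span (range (basis_of T))}"
  shows "quasi_action T \<gamma> z =
    (\<chi> i. exp (2 * of_real pi * \<i> * of_real (dual_basis (basis_of T) i q)) * z $ i)"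
proof -
  have "q \<in> \<gamma>" using assms(3) int_module.span_zero by force
  then have "(SOME q. q \<in> \<gamma>) \<in> \<gamma>" by (rule someI)
  then obtain l where l: "l \<in> int_span (range (basis_of T))" "(SOME q. q \<in> \<gamma>) = l + q"
    using assms(3) by blast
  have "exp (2 * of_real pi * \<i> * of_real (dual_basis (basis_of T) i (l + q))) =
      exp (2 * of_real pi * \<i> * of_real (dual_basis (basis_of T) i q))" for i
    using exp_2pi_Ints[OF dual_basis_int_span[OF assms(1) l(1)], of i]
    by (simp add: linear_add[OF linear_dual_basis[OF assms(1)]] distrib_left exp_add)
  then show ?thesis using assms(2) by (simp add: quasi_action_def l(2))
qed

lemma toric_class_eq:
  assumes "cone_fundamental_triple T" and "z \<in> toric_domain T"
  shows "toric_class T z =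
    {\<chi> i. exp (2 * of_real pi * \<i> * of_real (dual_basis (basis_of T) i q)) * z $ i |q. q \<in> lattice_of T}"
proof -
  have "toric_class T z = (\<lambda>q. quasi_action T {l + q |l. l \<in> int_span (range (basis_of T))} z) ` lattice_of T"
    unfolding toric_class_def orbit_def carrier_quasi_group by blast
  also have "\<dots> = (\<lambda>q. \<chi> i. exp (2 * of_real pi * \<i> * of_real (dual_basis (basis_of T) i q)) * z $ i) ` lattice_of T"
    by (rule image_cong[OF refl quasi_action_coset[OF assms refl]])
  finally show ?thesis by blast
qed

lemma toric_class_eqI:
  assumes T: "cone_fundamental_triple T" and z: "z \<in> toric_domain T" and q: "q \<in> lattice_of T"
    and w: "\<And>i. w $ i = exp (2 * of_real pi * \<i> * of_real (dual_basis (basis_of T) i q)) * z $ i"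
  shows "toric_class T w = toric_class T z"
proof -
  obtain S where S: "lattice_of T = int_span S" using lattice_int_span[OF T] .
  have wU: "w \<in> toric_domain T" using z w by (auto simp: toric_domain_def)
  note lin = linear_add[OF linear_dual_basis[OF T]] linear_diff[OF linear_dual_basis[OF T]]
  have "\<exists>p'\<in>lattice_of T. (\<chi> i. exp (2 * of_real pi * \<i> * of_real (dual_basis (basis_of T) i p)) * w $ i)
       = (\<chi> i. exp (2 * of_real pi * \<i> * of_real (dual_basis (basis_of T) i p')) * z $ i)"
    if "p \<in> lattice_of T" for p
    using that q unfolding S
    by (intro bexI[of _ "p + q"]) (auto simp: w lin exp_add distrib_left int_module.span_add)
  moreover have "\<exists>p'\<in>lattice_of T. (\<chi> i. exp (2 * of_real pi * \<i> * of_real (dual_basis (basis_of T) i p)) * z $ i)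
       = (\<chi> i. exp (2 * of_real pi * \<i> * of_real (dual_basis (basis_of T) i p')) * w $ i)"
    if "p \<in> lattice_of T" for p
    using that q unfolding S
    by (intro bexI[of _ "p - q"])
       (auto simp: w lin exp_diff right_diff_distrib int_module.span_diff)
  ultimately show ?thesis
    unfolding toric_class_eq[OF T z] toric_class_eq[OF T wU] by blast
qed

lemma cone_morphism_exponents:
  assumes "cone_fundamental_triple T1" "cone_fundamental_triple T2" "cone_morphism T1 T2 f"
    and h: "h \<in> ray_indices T1"
  shows "0 \<le> dual_basis (basis_of T2) i (f (basis_of T1 h))"
    and "i \<notin> ray_indices T2 \<Longrightarrow> dual_basis (basis_of T2) i (f (basis_of T1 h)) = 0"
proof -
  have c1: "cone_of T1 = nonneg_span (basis_of T1) (ray_indices T1)"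
    and c2: "cone_of T2 = nonneg_span (basis_of T2) (ray_indices T2)"
    using ray_indices_eq assms by blast+
  have "basis_of T1 h \<in> cone_of T1"
    unfolding c1 using h by (auto simp: nonneg_span_iff[OF assms(1)] dual_basis_basis[OF assms(1)])
  then have *: "f (basis_of T1 h) \<in> cone_of T2"
    using assms(3) by (auto simp: cone_morphism_def)
  show "i \<notin> ray_indices T2 \<Longrightarrow> dual_basis (basis_of T2) i (f (basis_of T1 h)) = 0"
    using * unfolding c2 nonneg_span_iff[OF assms(2)] by auto
  show "0 \<le> dual_basis (basis_of T2) i (f (basis_of T1 h))"
    using * unfolding c2 nonneg_span_iff[OF assms(2)] by (metis order_refl)
qed

lemma toric_monomials_domain:
  assumes "cone_fundamental_triple T1" "cone_fundamental_triple T2" "cone_morphism T1 T2 f"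
    and z: "z \<in> toric_domain T1"
  shows "toric_monomials T1 T2 f z x \<in> toric_domain T2"
proof -
  have "dual_basis (basis_of T2) i (f (basis_of T1 h)) = 0"
    if "i \<notin> ray_indices T2" "z $ h = 0" for i h
    by (rule cone_morphism_exponents(2)[OF assms(1-3)]) (use that z in \<open>auto simp: toric_domain_def\<close>)
  then show ?thesis
    by (auto simp: toric_domain_def toric_monomials_def real_power_def split: if_splits)
qed

lemma log_choice_ex: "\<exists>x. log_choice z x"
proof -
  have "z $ h = exp (2 * of_real pi * \<i> * (Ln (z $ h) / (2 * of_real pi * \<i>)))" if "z $ h \<noteq> 0" for h
    using that by simp
  then have "log_choice z (\<chi> h. Ln (z $ h) / (2 * of_real pi * \<i>))"
    unfolding log_choice_def by simp
  then show ?thesis ..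
qed

lemma toric_monomials_class:
  assumes T1: "cone_fundamental_triple T1" and T2: "cone_fundamental_triple T2"
    and f: "cone_morphism T1 T2 f"
    and z: "z \<in> toric_domain T1" and w: "w \<in> toric_domain T1"
    and zw: "toric_class T1 z = toric_class T1 w" and x: "log_choice z x" and y: "log_choice w y"
  shows "toric_class T2 (toric_monomials T1 T2 f w y) = toric_class T2 (toric_monomials T1 T2 f z x)"
proof -
  let ?e = "\<lambda>t::complex. exp (2 * of_real pi * \<i> * t)"
  let ?\<alpha> = "\<lambda>i. dual_basis (basis_of T1) i" and ?\<beta> = "\<lambda>i. dual_basis (basis_of T2) i"
  obtain S1 where S1: "lattice_of T1 = int_span S1" using lattice_int_span[OF T1] .
  obtain S2 where S2: "lattice_of T2 = int_span S2" using lattice_int_span[OF T2] .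
  have "0 \<in> lattice_of T1" unfolding S1 by (rule int_module.span_zero)
  then have "w \<in> toric_class T1 w"
    unfolding toric_class_eq[OF T1 w]
    by (intro CollectI exI[of _ 0]) (simp add: linear_0[OF linear_dual_basis[OF T1]] vec_eq_iff)
  then obtain q where q: "q \<in> lattice_of T1" and wq: "\<And>i. w $ i = ?e (of_real (?\<alpha> i q)) * z $ i"
    unfolding zw[symmetric] toric_class_eq[OF T1 z] by auto
  have "\<exists>k::int. z $ h \<noteq> 0 \<longrightarrow> y $ h = x $ h + of_real (?\<alpha> h q + of_int k)" for h
  proof (cases "z $ h = 0")
    case False
    then have "w $ h \<noteq> 0" by (simp add: wq)
    then have "?e (y $ h) = ?e (of_real (?\<alpha> h q) + x $ h)"
      using wq[of h] x y False by (simp add: log_choice_def distrib_left exp_add)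
    then obtain k :: int where
      "2 * of_real pi * \<i> * (y $ h) = 2 * of_real pi * \<i> * (of_real (?\<alpha> h q) + x $ h) + (of_int (2 * k) * of_real pi) * \<i>"
      unfolding exp_eq by auto
    then have "2 * of_real pi * \<i> * (y $ h) = 2 * of_real pi * \<i> * (x $ h + of_real (?\<alpha> h q + of_int k))"
      by (simp add: algebra_simps)
    then show ?thesis by auto
  qed auto
  then obtain k :: "_ \<Rightarrow> int" where k: "\<And>h. z $ h \<noteq> 0 \<Longrightarrow> y $ h = x $ h + of_real (?\<alpha> h q + of_int (k h))"
    by metis
  define p where "p = q + (\<Sum>h\<in>UNIV. of_int (k h) *\<^sub>R basis_of T1 h)"
  have lf: "linear f" using f by (simp add: cone_morphism_def)
  have "range (basis_of T1) \<subseteq> lattice_of T1"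
    using T1 by (simp add: cone_fundamental_triple_def)
  then have "p \<in> lattice_of T1"
    unfolding p_def using q unfolding S1
    by (intro int_module.span_add int_module.span_sum int_module.span_scale) auto
  then have fp: "f p \<in> lattice_of T2" using f by (auto simp: cone_morphism_def)
  have "p = (\<Sum>h\<in>UNIV. (?\<alpha> h q + of_int (k h)) *\<^sub>R basis_of T1 h)"
    unfolding p_def by (subst dual_basis_expansion[OF T1, of q]) (simp add: sum.distrib scaleR_add_left)
  then have \<beta>p: "?\<beta> i (f p) = (\<Sum>h\<in>UNIV. (?\<alpha> h q + of_int (k h)) * ?\<beta> i (f (basis_of T1 h)))" for i
    by (simp add: linear_sum[OF lf] linear_scale[OF lf] linear_sum[OF linear_dual_basis[OF T2]]
      linear_scale[OF linear_dual_basis[OF T2]])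
  have "toric_monomials T1 T2 f w y $ i = ?e (of_real (?\<beta> i (f p))) * toric_monomials T1 T2 f z x $ i" for i
  proof (cases "\<exists>h. z $ h = 0 \<and> ?\<beta> i (f (basis_of T1 h)) \<noteq> 0")
    case True
    then obtain h where h: "z $ h = 0" "?\<beta> i (f (basis_of T1 h)) \<noteq> 0" by blast
    then have "w $ h = 0" by (simp add: wq)
    then have "real_power (w $ h) (y $ h) (?\<beta> i (f (basis_of T1 h))) = 0"
      "real_power (z $ h) (x $ h) (?\<beta> i (f (basis_of T1 h))) = 0"
      using h by (auto simp: real_power_def)
    then have "toric_monomials T1 T2 f w y $ i = 0" "toric_monomials T1 T2 f z x $ i = 0"
      unfolding toric_monomials_def vec_lambda_beta by (blast intro: prod_zero[OF finite])+
    then show ?thesis by simp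
  next
    case False
    have "real_power (w $ h) (y $ h) (?\<beta> i (f (basis_of T1 h))) =
      ?e (of_real ((?\<alpha> h q + of_int (k h)) * ?\<beta> i (f (basis_of T1 h)))) *
      real_power (z $ h) (x $ h) (?\<beta> i (f (basis_of T1 h)))" for h
      using False by (cases "z $ h = 0") (auto simp: real_power_def wq k exp_add[symmetric] algebra_simps)
    then show ?thesis
      by (simp add: toric_monomials_def \<beta>p prod.distrib exp_sum sum_distrib_left of_real_sum
        del: of_real_mult)
  qed
  then show ?thesis
    by (intro toric_class_eqI[OF T2 toric_monomials_domain[OF T1 T2 f z] fp])
qed

lemma affine_toric_morphism_class:
  assumes T1: "cone_fundamental_triple T1" and T2: "cone_fundamental_triple T2"
    and f: "cone_morphism T1 T2 f"
    and z: "z \<in> toric_domain T1" and x: "log_choice z x"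
  shows "affine_toric_morphism T1 T2 f (toric_class T1 z) = toric_class T2 (toric_monomials T1 T2 f z x)"
proof -
  have "toric_class T1 z \<in> toric_quasifold T1"
    using z by (auto simp: toric_class_def toric_quasifold_def orbits_def)
  moreover have "(THE q. \<exists>z'\<in>toric_domain T1. \<exists>x'. log_choice z' x' \<and> toric_class T1 z = toric_class T1 z' \<and>
      q = toric_class T2 (toric_monomials T1 T2 f z' x')) = toric_class T2 (toric_monomials T1 T2 f z x)"
  proof (rule the_equality)
    fix q
    assume "\<exists>z'\<in>toric_domain T1. \<exists>x'. log_choice z' x' \<and> toric_class T1 z = toric_class T1 z' \<and>
      q = toric_class T2 (toric_monomials T1 T2 f z' x')"
    then obtain z' x' where z': "z' \<in> toric_domain T1" "log_choice z' x'"
        "toric_class T1 z = toric_class T1 z'" "q = toric_class T2 (toric_monomials T1 T2 f z' x')"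
      by blast
    show "q = toric_class T2 (toric_monomials T1 T2 f z x)"
      unfolding z'(4) by (rule toric_monomials_class[OF T1 T2 f z z'(1,3) x z'(2)])
  qed (use z x in blast)
  ultimately show ?thesis
    by (simp add: affine_toric_morphism_def)
qed

end

theory Submission
  imports Defs
begin

text \<open>A monomial is \<open>0\<close> if a variable with non-zero exponent vanishes, and otherwise the exponential of
  the linear form in the chosen logarithms given by its exponents. So composing monomial maps
  multiplies the exponent matrices, provided the composite exponent of a vanishing variable is \<open>0\<close> only
  when each product contributing to it is; this holds because all these products are
  non-negative, which is where \<open>f(\<delta>\<^sub>1) \<subseteq> \<delta>\<^sub>2\<close> and \<open>g(\<delta>\<^sub>2) \<subseteq> \<delta>\<^sub>3\<close> enter.\<close>

lemma toric_quasifold_eq: "toric_quasifold T = toric_class T ` toric_domain T"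
  by (auto simp: toric_quasifold_def toric_class_def orbits_def)

lemma cone_morphism_comp:
  "cone_morphism T1 T2 f \<Longrightarrow> cone_morphism T2 T3 g \<Longrightarrow> cone_morphism T1 T3 (g \<circ> f)"
  by (auto simp: cone_morphism_def image_subset_iff intro: linear_compose)

lemma cone_morphism_id: "cone_morphism T T id"
  by (simp add: cone_morphism_def linear_id)

text \<open>Expanding \<open>x\<close> in the basis of \<open>T2\<close> and using linearity; at
  \<open>x = f (basis_of T1 h)\<close> this is the product of the exponent matrices of
  \<open>g\<close> and \<open>f\<close>.\<close>

lemma dual_basis_comp:
  assumes T2: "cone_fundamental_triple T2" and T3: "cone_fundamental_triple T3" and g: "linear g"
  shows "dual_basis (basis_of T3) k (g x) =
    (\<Sum>i\<in>UNIV. dual_basis (basis_of T3) k (g (basis_of T2 i)) * dual_basis (basis_of T2) i x)"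
  by (subst (1) dual_basis_expansion[OF T2, of x])
     (simp add: linear_sum[OF g] linear_scale[OF g] linear_sum[OF linear_dual_basis[OF T3]]
       linear_scale[OF linear_dual_basis[OF T3]] mult.commute)

lemma toric_monomials_nth:
  "toric_monomials T1 T2 f z x $ i =
    (if \<exists>h. z $ h = 0 \<and> dual_basis (basis_of T2) i (f (basis_of T1 h)) \<noteq> 0 then 0
     else exp (2 * of_real pi * \<i> *
       (\<Sum>h\<in>UNIV. of_real (dual_basis (basis_of T2) i (f (basis_of T1 h))) * x $ h)))"
proof (cases "\<exists>h. z $ h = 0 \<and> dual_basis (basis_of T2) i (f (basis_of T1 h)) \<noteq> 0")
  case True
  then show ?thesis
    by (auto simp: toric_monomials_def real_power_def intro!: prod_zero)
next
  case False
  \<comment> \<open>A vanishing \<open>z $ h\<close> has exponent 0 here, so both sides are 1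
    whatever the value of \<open>x $ h\<close>.\<close>
  then have "real_power (z $ h) (x $ h) (dual_basis (basis_of T2) i (f (basis_of T1 h))) =
    exp (2 * of_real pi * \<i> * (of_real (dual_basis (basis_of T2) i (f (basis_of T1 h))) * x $ h))" for h
    by (auto simp: real_power_def mult.assoc)
  with False show ?thesis
    by (simp add: toric_monomials_def exp_sum sum_distrib_left)
qed

text \<open>Provides logarithms at the intermediate point that are linear in \<open>x\<close>, so
  that the second morphism can be evaluated there.\<close>

lemma log_choice_toric_monomials:
  "log_choice (toric_monomials T1 T2 f z x)
     (\<chi> i. \<Sum>h\<in>UNIV. of_real (dual_basis (basis_of T2) i (f (basis_of T1 h))) * x $ h)"
  by (auto simp: log_choice_def toric_monomials_nth)

text \<open>With these logarithms the composition law holds for points already, before passing to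
  classes.\<close>

lemma toric_monomials_comp:
  assumes T1: "cone_fundamental_triple T1" and T2: "cone_fundamental_triple T2"
    and T3: "cone_fundamental_triple T3"
    and f: "cone_morphism T1 T2 f" and g: "cone_morphism T2 T3 g"
    and z: "z \<in> toric_domain T1"
  shows "toric_monomials T2 T3 g (toric_monomials T1 T2 f z x)
      (\<chi> i. \<Sum>h\<in>UNIV. of_real (dual_basis (basis_of T2) i (f (basis_of T1 h))) * x $ h)
    = toric_monomials T1 T3 (g \<circ> f) z x"
proof -
  define a where "a i h = dual_basis (basis_of T2) i (f (basis_of T1 h))" for i h
  define b where "b k i = dual_basis (basis_of T3) k (g (basis_of T2 i))" for k i
  define c where "c k h = dual_basis (basis_of T3) k ((g \<circ> f) (basis_of T1 h))" for k h
  have c: "c k h = (\<Sum>i\<in>UNIV. b k i * a i h)" for k h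
    using dual_basis_comp[OF T2 T3, of g k "f (basis_of T1 h)"] g
    by (simp add: a_def b_def c_def cone_morphism_def)
  have nonneg: "0 \<le> b k i * a i h" if "z $ h = 0" for k i h
  proof -
    have h: "h \<in> ray_indices T1" using z that by (auto simp: toric_domain_def)
    show ?thesis
    \<comment> \<open>Outside \<open>ray_indices T2\<close> the sign of \<open>b k i\<close> is not
      controlled, but there \<open>a i h = 0\<close>, because \<open>f\<close> sends the ray
      generator \<open>basis_of T1 h\<close> into the cone of \<open>T2\<close>.\<close>
    proof (cases "i \<in> ray_indices T2")
      case True
      show ?thesis
        unfolding a_def b_def
        by (intro mult_nonneg_nonneg cone_morphism_exponents(1)[OF T2 T3 g True]
            cone_morphism_exponents(1)[OF T1 T2 f h])
    next
      case False
      then show ?thesis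
        using cone_morphism_exponents(2)[OF T1 T2 f h] by (simp add: a_def)
    qed
  qed
  have "c k h = 0 \<longleftrightarrow> (\<forall>i. b k i * a i h = 0)" if "z $ h = 0" for k h
    unfolding c using nonneg[OF that] by (simp add: sum_nonneg_eq_0_iff)
  \<comment> \<open>The left side says that a vanishing intermediate coordinate enters the
    \<open>k\<close>-th monomial of \<open>g\<close>; the right side is the vanishing criterion for
    \<open>g \<circ> f\<close>.\<close>
  then have zero: "(\<exists>i. (\<exists>h. z $ h = 0 \<and> a i h \<noteq> 0) \<and> b k i \<noteq> 0) \<longleftrightarrow> (\<exists>h. z $ h = 0 \<and> c k h \<noteq> 0)" for k
    by (metis mult_eq_0_iff)
  have exponent: "(\<Sum>i\<in>UNIV. of_real (b k i) * (\<Sum>h\<in>UNIV. of_real (a i h) * x $ h)) =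
      (\<Sum>h\<in>UNIV. of_real (c k h) * x $ h)" for k
    unfolding c of_real_sum sum_distrib_left sum_distrib_right
    by (subst sum.swap) (simp add: mult.assoc)
  \<comment> \<open>Since \<open>exp\<close> has no zeros, the first case of
    \<open>toric_monomials_nth\<close> is exactly the vanishing of the coordinate.\<close>
  have monomial_zero: "toric_monomials T1 T2 f z x $ i = 0 \<longleftrightarrow> (\<exists>h. z $ h = 0 \<and> a i h \<noteq> 0)" for i
    by (simp add: toric_monomials_nth a_def)
  show ?thesis
    unfolding vec_eq_iff
      toric_monomials_nth[of T2 T3 g] toric_monomials_nth[of T1 T3 "g \<circ> f"] monomial_zero
    unfolding a_def[symmetric] b_def[symmetric] c_def[symmetric] vec_lambda_beta exponent zero
    by simp
qed

text \<open>The exponent matrix is the identity, and the power with exponent 1 returns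
  \<open>z $ h\<close> because \<open>x\<close> consists of logarithms of \<open>z\<close>.\<close>

lemma toric_monomials_id:
  assumes T: "cone_fundamental_triple T" and x: "log_choice z x"
  shows "toric_monomials T T id z x = z"
proof -
  have "real_power (z $ h) (x $ h) (dual_basis (basis_of T) i (basis_of T h)) =
      (if h = i then z $ h else 1)" for h i
    using x by (auto simp: dual_basis_basis[OF T] real_power_def log_choice_def)
  then show ?thesis
    by (simp add: toric_monomials_def vec_eq_iff)
qed

lemma affine_toric_morphism_funcset:
  assumes "cone_fundamental_triple T1" "cone_fundamental_triple T2" "cone_morphism T1 T2 f"
  shows "affine_toric_morphism T1 T2 f \<in> toric_quasifold T1 \<rightarrow> toric_quasifold T2"
proof -
  have "affine_toric_morphism T1 T2 f (toric_class T1 z) \<in> toric_class T2 ` toric_domain T2"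
    if z: "z \<in> toric_domain T1" for z
  proof -
    obtain x where "log_choice z x" using log_choice_ex by blast
    then show ?thesis
      using affine_toric_morphism_class[OF assms z] toric_monomials_domain[OF assms z] by auto
  qed
  then show ?thesis unfolding toric_quasifold_eq by auto
qed

lemma affine_toric_morphism_comp:
  assumes T1: "cone_fundamental_triple T1" and T2: "cone_fundamental_triple T2"
    and T3: "cone_fundamental_triple T3"
    and f: "cone_morphism T1 T2 f" and g: "cone_morphism T2 T3 g"
  shows "compose (toric_quasifold T1) (affine_toric_morphism T2 T3 g) (affine_toric_morphism T1 T2 f)
    = affine_toric_morphism T1 T3 (g \<circ> f)"
\<comment> \<open>Both sides are \<open>undefined\<close> off the quasifold, so comparing them on
  classes suffices.\<close>
proof (rule extensionalityI[where A = "toric_quasifold T1"])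
  fix p assume p: "p \<in> toric_quasifold T1"
  then obtain z where z: "z \<in> toric_domain T1" and pz: "p = toric_class T1 z"
    unfolding toric_quasifold_eq by blast
  obtain x where x: "log_choice z x" using log_choice_ex by blast
  show "compose (toric_quasifold T1) (affine_toric_morphism T2 T3 g) (affine_toric_morphism T1 T2 f) p
    = affine_toric_morphism T1 T3 (g \<circ> f) p"
    \<comment> \<open>The value on a class is the same for every representative and choice of
      logarithms, so the monomials of \<open>f\<close> serve as representative for the second
      morphism.\<close>
    unfolding compose_eq[OF p] unfolding pz
      affine_toric_morphism_class[OF T1 T2 f z x]
      affine_toric_morphism_class[OF T2 T3 g toric_monomials_domain[OF T1 T2 f z]
        log_choice_toric_monomials]
      affine_toric_morphism_class[OF T1 T3 cone_morphism_comp[OF f g] z x]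
      toric_monomials_comp[OF T1 T2 T3 f g z] ..
qed (simp_all add: affine_toric_morphism_def)

lemma affine_toric_morphism_id:
  assumes T: "cone_fundamental_triple T"
  shows "affine_toric_morphism T T id = (\<lambda>p\<in>toric_quasifold T. p)"
proof (rule extensionalityI[where A = "toric_quasifold T"])
  fix p assume p: "p \<in> toric_quasifold T"
  then obtain z where z: "z \<in> toric_domain T" and pz: "p = toric_class T z"
    unfolding toric_quasifold_eq by blast
  obtain x where x: "log_choice z x" using log_choice_ex by blast
  show "affine_toric_morphism T T id p = (\<lambda>p\<in>toric_quasifold T. p) p"
    using p affine_toric_morphism_class[OF T T cone_morphism_id z x] toric_monomials_id[OF T x]
    by (simp add: pz)
qed (simp_all add: affine_toric_morphism_def)

theorem theorem3p5:
  fixes T1 :: "'n::finite cone_triple"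
    and T2 :: "'l::finite cone_triple"
    and T3 :: "'m::finite cone_triple"
    and f :: "real ^ 'n \<Rightarrow> real ^ 'l"
    and g :: "real ^ 'l \<Rightarrow> real ^ 'm"
    and T :: "'k::finite cone_triple"
  shows "(cone_fundamental_triple T1 \<and> cone_fundamental_triple T2 \<and> cone_fundamental_triple T3 \<and>
            cone_morphism T1 T2 f \<and> cone_morphism T2 T3 g \<longrightarrow>
            cone_morphism T1 T3 (g \<circ> f) \<and>
            affine_toric_morphism T1 T2 f \<in> toric_quasifold T1 \<rightarrow> toric_quasifold T2 \<and>
            affine_toric_morphism T2 T3 g \<in> toric_quasifold T2 \<rightarrow> toric_quasifold T3 \<and>
            compose (toric_quasifold T1) (affine_toric_morphism T2 T3 g) (affine_toric_morphism T1 T2 f)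
              = affine_toric_morphism T1 T3 (g \<circ> f))
       \<and> (cone_fundamental_triple T \<longrightarrow>
            cone_morphism T T id \<and>
            affine_toric_morphism T T id = (\<lambda>p\<in>toric_quasifold T. p))"
  by (intro conjI impI; (elim conjE)?; rule cone_morphism_comp cone_morphism_id
      affine_toric_morphism_funcset affine_toric_morphism_comp affine_toric_morphism_id; assumption)

end
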